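(* Let $\mathsf{C}$ be a category with limits (resp. colimits), let $\mathsf{D}$ be a category with colimits (resp. limits), and let $\mathsf{T}$ be any time category. If $K \colon \mathsf{C}^{op} \to \mathsf{D}$ is a functor taking limits to colimits (resp. colimits to limits), then composition with $K$ determines a functor from persistent (resp. cumulative) $\mathsf{C}$-narratives to cumulative (resp. persistent) $\mathsf{D}$-narratives.
   Context: Let $\mathsf{I}$ (resp. $\mathsf{I}_{\mathbb{N}}$) be the poset, regarded as a category, whose objects are the closed intervals of $\mathbb{R}$ (resp. of $\mathbb{N}$) and whose morphisms are the inclusions of intervals; it is a join-semilattice. A time category is any sub-join-semilattice $\mathsf{T}$ of $\mathsf{I}$ or of $\mathsf{I}_{\mathbb{N}}$. Time categories are equipped with the Johnstone coverage, in which any cover of an interval $[a,b]$ is generated by partitions into two closed intervals $([a,p],[p,b])$. For a category $\mathsf{E}$ with pullbacks, an $\mathsf{E}$-valued sheaf on $\mathsf{T}$ is a functor $F \colon \mathsf{T}^{op} \to \mathsf{E}$ such that for any interval $[a,b]$ and any cover $([a,p],[p,b])$ of this interval, $F([a,b])$ is the pullback $F([a,p]) \times_{F([p,p])} F([p,b])$. For a category $\mathsf{E}$ with pushouts, an $\mathsf{E}$-valued cosheaf on $\mathsf{T}$ is a functor $\hat{F} \colon \mathsf{T} \to \mathsf{E}$ such that for any interval $[a,b]$ and any cover $([a,p],[p,b])$ of this interval, $\hat{F}([a,b])$ is the pushout $\hat{F}([a,p]) +_{\hat{F}([p,p])} \hat{F}([p,b])$. The category of persistent $\mathsf{E}$-narratives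 (with $\mathsf{T}$-time) is the category of $\mathsf{E}$-valued sheaves on $\mathsf{T}$, and the category of cumulative $\mathsf{E}$-narratives (with $\mathsf{T}$-time) is the category of $\mathsf{E}$-valued cosheaves on $\mathsf{T}$; in both cases the morphisms are natural transformations. Here $K$ is a contravariant functor from $\mathsf{C}$ to $\mathsf{D}$, and "taking limits to colimits" means taking limits in $\mathsf{C}$ to colimits in $\mathsf{D}$ (dually for "colimits to limits"). *)

theory Defs
  imports Complex_Main "HOL-Library.FuncSet" "HOL-Library.Infinite_Typeclass"
begin

section \<open>Categories\<close>

record ('o, 'a) cat =
  Obj :: "'o set"
  Arr :: "'a set"
  Dom :: "'a \<Rightarrow> 'o"
  Cod :: "'a \<Rightarrow> 'o"
  Ident :: "'o \<Rightarrow> 'a"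
  Comp :: "'a \<Rightarrow> 'a \<Rightarrow> 'a"  \<comment> \<open>in applicative order: \<open>Comp C g f\<close> is \<open>g\<close> after \<open>f\<close>\<close>

definition Hom :: "('o, 'a) cat \<Rightarrow> 'o \<Rightarrow> 'o \<Rightarrow> 'a set" where
  "Hom C x y = {f \<in> Arr C. Dom C f = x \<and> Cod C f = y}"

locale category =
  fixes C :: "('o, 'a) cat"
  assumes Dom_closed: "f \<in> Arr C \<Longrightarrow> Dom C f \<in> Obj C"
    and Cod_closed: "f \<in> Arr C \<Longrightarrow> Cod C f \<in> Obj C"
    and Ident_closed: "x \<in> Obj C \<Longrightarrow> Ident C x \<in> Hom C x x"
    and Comp_closed: "f \<in> Hom C x y \<Longrightarrow> g \<in> Hom C y z \<Longrightarrow> Comp C g f \<in> Hom C x z"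
    and Comp_Ident_left: "f \<in> Hom C x y \<Longrightarrow> Comp C (Ident C y) f = f"
    and Comp_Ident_right: "f \<in> Hom C x y \<Longrightarrow> Comp C f (Ident C x) = f"
    and Comp_assoc: "f \<in> Hom C w x \<Longrightarrow> g \<in> Hom C x y \<Longrightarrow> h \<in> Hom C y z
      \<Longrightarrow> Comp C h (Comp C g f) = Comp C (Comp C h g) f"

definition op_cat :: "('o, 'a) cat \<Rightarrow> ('o, 'a) cat" where
  "op_cat C = \<lparr> Obj = Obj C, Arr = Arr C, Dom = Cod C, Cod = Dom C,
     Ident = Ident C, Comp = (\<lambda>g f. Comp C f g) \<rparr>"

definition full_subcategory :: "('o, 'a) cat \<Rightarrow> 'o set \<Rightarrow> ('o, 'a) cat" where
  "full_subcategory C S = \<lparr> Obj = Obj C \<inter> S,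
     Arr = {f \<in> Arr C. Dom C f \<in> S \<and> Cod C f \<in> S},
     Dom = Dom C, Cod = Cod C, Ident = Ident C, Comp = Comp C \<rparr>"


section \<open>Functors and natural transformations\<close>

record ('o, 'a, 'p, 'b) functor_data =
  fobj :: "'o \<Rightarrow> 'p"
  farr :: "'a \<Rightarrow> 'b"

text \<open>
  The two maps of a functor, and the components of a natural transformation, are extensional
  (\<open>undefined\<close> outside their domain), so that HOL equality is equality of functors and of
  natural transformations.  This is needed for them to be the objects and arrows of a category.
\<close>

definition is_functor ::
    "('o, 'a) cat \<Rightarrow> ('p, 'b) cat \<Rightarrow> ('o, 'a, 'p, 'b) functor_data \<Rightarrow> bool" where
  "is_functor A B F \<longleftrightarrow> category A \<and> category B \<and>
     fobj F \<in> Obj A \<rightarrow>\<^sub>E Obj B \<and>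
     farr F \<in> Arr A \<rightarrow>\<^sub>E Arr B \<and>
     (\<forall>f \<in> Arr A. farr F f \<in> Hom B (fobj F (Dom A f)) (fobj F (Cod A f))) \<and>
     (\<forall>x \<in> Obj A. farr F (Ident A x) = Ident B (fobj F x)) \<and>
     (\<forall>f \<in> Arr A. \<forall>g \<in> Arr A. Cod A f = Dom A g \<longrightarrow>
        farr F (Comp A g f) = Comp B (farr F g) (farr F f))"

text \<open>
  A functor \<open>F\<close> from \<open>A\<close> to \<open>B\<close> and its opposite, from \<open>op_cat A\<close> to \<open>op_cat B\<close>, have the same
  object and arrow maps, hence the same \<open>functor_data\<close>.  So \<open>functor_comp (op_cat A) K F\<close> is the
  composite of the opposite of \<open>F\<close> with a contravariant \<open>K\<close>, that is, a functor \<open>K\<close> on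
  \<open>op_cat B\<close>.  The first argument is the source of the composite.
\<close>

definition functor_comp ::
    "('o, 'a) cat \<Rightarrow> ('p, 'b, 'q, 'c) functor_data \<Rightarrow> ('o, 'a, 'p, 'b) functor_data
      \<Rightarrow> ('o, 'a, 'q, 'c) functor_data" where
  "functor_comp A K F = \<lparr> fobj = (\<lambda>x\<in>Obj A. fobj K (fobj F x)),
     farr = (\<lambda>f\<in>Arr A. farr K (farr F f)) \<rparr>"

definition natural_transformation ::
    "('o, 'a) cat \<Rightarrow> ('p, 'b) cat \<Rightarrow> ('o, 'a, 'p, 'b) functor_data
      \<Rightarrow> ('o, 'a, 'p, 'b) functor_data \<Rightarrow> ('o \<Rightarrow> 'b) \<Rightarrow> bool" where
  "natural_transformation A B F G \<eta> \<longleftrightarrow> is_functor A B F \<and> is_functor A B G \<and>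
     \<eta> \<in> extensional (Obj A) \<and>
     (\<forall>x \<in> Obj A. \<eta> x \<in> Hom B (fobj F x) (fobj G x)) \<and>
     (\<forall>f \<in> Arr A. Comp B (\<eta> (Cod A f)) (farr F f) = Comp B (farr G f) (\<eta> (Dom A f)))"

type_synonym ('o, 'a, 'p, 'b) nat_trans =
  "('o, 'a, 'p, 'b) functor_data \<times> ('o, 'a, 'p, 'b) functor_data \<times> ('o \<Rightarrow> 'b)"

definition functor_category ::
    "('o, 'a) cat \<Rightarrow> ('p, 'b) cat
      \<Rightarrow> (('o, 'a, 'p, 'b) functor_data, ('o, 'a, 'p, 'b) nat_trans) cat" where
  "functor_category A B = \<lparr>
     Obj = {F. is_functor A B F},
     Arr = {(F, G, \<eta>). natural_transformation A B F G \<eta>},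
     Dom = (\<lambda>(F, G, \<eta>). F),
     Cod = (\<lambda>(F, G, \<eta>). G),
     Ident = (\<lambda>F. (F, F, \<lambda>x\<in>Obj A. Ident B (fobj F x))),
     Comp = (\<lambda>(G', H, \<theta>) (F, G, \<eta>). (F, H, \<lambda>x\<in>Obj A. Comp B (\<theta> x) (\<eta> x))) \<rparr>"


section \<open>Limits and colimits\<close>

definition is_cone ::
    "('i, 'j) cat \<Rightarrow> ('o, 'a) cat \<Rightarrow> ('i, 'j, 'o, 'a) functor_data \<Rightarrow> 'o \<Rightarrow> ('i \<Rightarrow> 'a) \<Rightarrow> bool" where
  "is_cone J C F L \<pi> \<longleftrightarrow> L \<in> Obj C \<and>
     (\<forall>i \<in> Obj J. \<pi> i \<in> Hom C L (fobj F i)) \<and>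
     (\<forall>u \<in> Arr J. Comp C (farr F u) (\<pi> (Dom J u)) = \<pi> (Cod J u))"

definition is_limit ::
    "('i, 'j) cat \<Rightarrow> ('o, 'a) cat \<Rightarrow> ('i, 'j, 'o, 'a) functor_data \<Rightarrow> 'o \<Rightarrow> ('i \<Rightarrow> 'a) \<Rightarrow> bool" where
  "is_limit J C F L \<pi> \<longleftrightarrow> is_cone J C F L \<pi> \<and>
     (\<forall>M \<mu>. is_cone J C F M \<mu> \<longrightarrow>
        (\<exists>!h. h \<in> Hom C M L \<and> (\<forall>i \<in> Obj J. Comp C (\<pi> i) h = \<mu> i)))"

definition is_cocone ::
    "('i, 'j) cat \<Rightarrow> ('o, 'a) cat \<Rightarrow> ('i, 'j, 'o, 'a) functor_data \<Rightarrow> 'o \<Rightarrow> ('i \<Rightarrow> 'a) \<Rightarrow> bool" where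
  "is_cocone J C F L \<iota> \<longleftrightarrow> L \<in> Obj C \<and>
     (\<forall>i \<in> Obj J. \<iota> i \<in> Hom C (fobj F i) L) \<and>
     (\<forall>u \<in> Arr J. Comp C (\<iota> (Cod J u)) (farr F u) = \<iota> (Dom J u))"

definition is_colimit ::
    "('i, 'j) cat \<Rightarrow> ('o, 'a) cat \<Rightarrow> ('i, 'j, 'o, 'a) functor_data \<Rightarrow> 'o \<Rightarrow> ('i \<Rightarrow> 'a) \<Rightarrow> bool" where
  "is_colimit J C F L \<iota> \<longleftrightarrow> is_cocone J C F L \<iota> \<and>
     (\<forall>M \<mu>. is_cocone J C F M \<mu> \<longrightarrow>
        (\<exists>!h. h \<in> Hom C L M \<and> (\<forall>i \<in> Obj J. Comp C h (\<iota> i) = \<mu> i)))"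

text \<open>
  A type \<open>'u\<close> plays the role of the universe with respect to which diagrams are small: a small
  shape is a category whose objects and arrows form subsets of \<open>'u\<close>.  Since \<open>'u\<close> is an arbitrary
  infinite type, every small category can occur as a shape for a suitable \<open>'u\<close>, and every finite
  one occurs for every \<open>'u\<close>.
\<close>

definition has_limits :: "'u::infinite itself \<Rightarrow> ('o, 'a) cat \<Rightarrow> bool" where
  "has_limits U C \<longleftrightarrow>
     (\<forall>(J :: ('u, 'u) cat) F. is_functor J C F \<longrightarrow> (\<exists>L \<pi>. is_limit J C F L \<pi>))"

definition has_colimits :: "'u::infinite itself \<Rightarrow> ('o, 'a) cat \<Rightarrow> bool" where
  "has_colimits U C \<longleftrightarrow>
     (\<forall>(J :: ('u, 'u) cat) F. is_functor J C F \<longrightarrow> (\<exists>L \<iota>. is_colimit J C F L \<iota>))"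

definition takes_limits_to_colimits ::
    "'u::infinite itself \<Rightarrow> ('o, 'a) cat \<Rightarrow> ('p, 'b) cat \<Rightarrow> ('o, 'a, 'p, 'b) functor_data \<Rightarrow> bool" where
  "takes_limits_to_colimits U C D K \<longleftrightarrow>
     (\<forall>(J :: ('u, 'u) cat) F L \<pi>. is_functor J C F \<and> is_limit J C F L \<pi> \<longrightarrow>
        is_colimit (op_cat J) D (functor_comp (op_cat J) K F) (fobj K L) (\<lambda>i. farr K (\<pi> i)))"

definition takes_colimits_to_limits ::
    "'u::infinite itself \<Rightarrow> ('o, 'a) cat \<Rightarrow> ('p, 'b) cat \<Rightarrow> ('o, 'a, 'p, 'b) functor_data \<Rightarrow> bool" where
  "takes_colimits_to_limits U C D K \<longleftrightarrow>
     (\<forall>(J :: ('u, 'u) cat) F L \<iota>. is_functor J C F \<and> is_colimit J C F L \<iota> \<longrightarrow>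
        is_limit (op_cat J) D (functor_comp (op_cat J) K F) (fobj K L) (\<lambda>i. farr K (\<iota> i)))"

text \<open>
  \<open>is_pullback C f g p q\<close>: the pair \<open>p\<close>, \<open>q\<close> is a pullback of the cospan \<open>f\<close>, \<open>g\<close>, where \<open>p\<close>
  ends at the source of \<open>f\<close> and \<open>q\<close> at that of \<open>g\<close>.  Dually, in \<open>is_pushout C f g p q\<close> the
  arrow \<open>p\<close> starts at the target of \<open>f\<close> and \<open>q\<close> at that of \<open>g\<close>.
\<close>

definition is_pullback :: "('o, 'a) cat \<Rightarrow> 'a \<Rightarrow> 'a \<Rightarrow> 'a \<Rightarrow> 'a \<Rightarrow> bool" where
  "is_pullback C f g p q \<longleftrightarrow>
     f \<in> Arr C \<and> g \<in> Arr C \<and> Cod C f = Cod C g \<and>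
     p \<in> Hom C (Dom C p) (Dom C f) \<and> q \<in> Hom C (Dom C p) (Dom C g) \<and>
     Comp C f p = Comp C g q \<and>
     (\<forall>x. \<forall>p' \<in> Hom C x (Dom C f). \<forall>q' \<in> Hom C x (Dom C g).
        Comp C f p' = Comp C g q' \<longrightarrow>
        (\<exists>!h. h \<in> Hom C x (Dom C p) \<and> Comp C p h = p' \<and> Comp C q h = q'))"

definition is_pushout :: "('o, 'a) cat \<Rightarrow> 'a \<Rightarrow> 'a \<Rightarrow> 'a \<Rightarrow> 'a \<Rightarrow> bool" where
  "is_pushout C f g p q \<longleftrightarrow>
     f \<in> Arr C \<and> g \<in> Arr C \<and> Dom C f = Dom C g \<and>
     p \<in> Hom C (Cod C f) (Cod C p) \<and> q \<in> Hom C (Cod C g) (Cod C p) \<and>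
     Comp C p f = Comp C q g \<and>
     (\<forall>x. \<forall>p' \<in> Hom C (Cod C f) x. \<forall>q' \<in> Hom C (Cod C g) x.
        Comp C p' f = Comp C q' g \<longrightarrow>
        (\<exists>!h. h \<in> Hom C (Cod C p) x \<and> Comp C h p = p' \<and> Comp C h q = q'))"


section \<open>Time categories\<close>

text \<open>
  The timeline \<open>X\<close> is \<open>UNIV\<close> for the real line, or \<open>\<nat>\<close>, the natural numbers as a set of reals.
  Closed intervals are nonempty and bounded.
\<close>

definition ivl :: "real set \<Rightarrow> real \<Rightarrow> real \<Rightarrow> real set" where
  "ivl X a b = {t \<in> X. a \<le> t \<and> t \<le> b}"

definition closed_intervals :: "real set \<Rightarrow> real set set" where
  "closed_intervals X = {ivl X a b | a b. a \<in> X \<and> b \<in> X \<and> a \<le> b}"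

definition is_join :: "'x set set \<Rightarrow> 'x set \<Rightarrow> 'x set \<Rightarrow> 'x set \<Rightarrow> bool" where
  "is_join P A B S \<longleftrightarrow> S \<in> P \<and> A \<subseteq> S \<and> B \<subseteq> S \<and> (\<forall>S' \<in> P. A \<subseteq> S' \<and> B \<subseteq> S' \<longrightarrow> S \<subseteq> S')"

definition sub_join_semilattice :: "'x set set \<Rightarrow> 'x set set \<Rightarrow> bool" where
  "sub_join_semilattice T P \<longleftrightarrow> T \<subseteq> P \<and> (\<forall>A \<in> T. \<forall>B \<in> T. \<forall>S. is_join P A B S \<longrightarrow> S \<in> T)"

definition time_category :: "real set \<Rightarrow> real set set \<Rightarrow> bool" where
  "time_category X T \<longleftrightarrow> (X = UNIV \<or> X = \<nat>) \<and> sub_join_semilattice T (closed_intervals X)"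

text \<open>The inclusion of \<open>A\<close> in \<open>B\<close> is the arrow \<open>(A, B)\<close>.\<close>

definition poset_cat :: "'x set set \<Rightarrow> ('x set, 'x set \<times> 'x set) cat" where
  "poset_cat T = \<lparr> Obj = T, Arr = {(A, B). A \<in> T \<and> B \<in> T \<and> A \<subseteq> B}, Dom = fst, Cod = snd,
     Ident = (\<lambda>A. (A, A)), Comp = (\<lambda>(B', C) (A, B). (A, C)) \<rparr>"


section \<open>Sheaves, cosheaves and narratives\<close>

text \<open>
  The pair \<open>[a,p]\<close>, \<open>[p,b]\<close> covers \<open>[a,b]\<close> in \<open>T\<close>.  A sub-join-semilattice need not contain the
  overlap \<open>[p,p]\<close>, at which the pullback (or pushout) in the gluing condition is formed; such
  pairs impose no condition.
\<close>

definition is_cover :: "real set \<Rightarrow> real set set \<Rightarrow> real \<Rightarrow> real \<Rightarrow> real \<Rightarrow> bool" where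
  "is_cover X T a p b \<longleftrightarrow> a \<in> X \<and> p \<in> X \<and> b \<in> X \<and> a \<le> p \<and> p \<le> b \<and>
     ivl X a b \<in> T \<and> ivl X a p \<in> T \<and> ivl X p b \<in> T \<and> ivl X p p \<in> T"

type_synonym ('o, 'a) narrative = "(real set, real set \<times> real set, 'o, 'a) functor_data"

definition is_sheaf ::
    "real set \<Rightarrow> real set set \<Rightarrow> ('o, 'a) cat \<Rightarrow> ('o, 'a) narrative \<Rightarrow> bool" where
  "is_sheaf X T E F \<longleftrightarrow> is_functor (op_cat (poset_cat T)) E F \<and>
     (\<forall>a p b. is_cover X T a p b \<longrightarrow>
        is_pullback E (farr F (ivl X p p, ivl X a p)) (farr F (ivl X p p, ivl X p b))
          (farr F (ivl X a p, ivl X a b)) (farr F (ivl X p b, ivl X a b)))"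

definition is_cosheaf ::
    "real set \<Rightarrow> real set set \<Rightarrow> ('o, 'a) cat \<Rightarrow> ('o, 'a) narrative \<Rightarrow> bool" where
  "is_cosheaf X T E F \<longleftrightarrow> is_functor (poset_cat T) E F \<and>
     (\<forall>a p b. is_cover X T a p b \<longrightarrow>
        is_pushout E (farr F (ivl X p p, ivl X a p)) (farr F (ivl X p p, ivl X p b))
          (farr F (ivl X a p, ivl X a b)) (farr F (ivl X p b, ivl X a b)))"

type_synonym ('o, 'a) narrative_cat =
  "(('o, 'a) narrative, (real set, real set \<times> real set, 'o, 'a) nat_trans) cat"

definition persistent_narratives ::
    "real set \<Rightarrow> real set set \<Rightarrow> ('o, 'a) cat \<Rightarrow> ('o, 'a) narrative_cat" where
  "persistent_narratives X T E =
     full_subcategory (functor_category (op_cat (poset_cat T)) E) {F. is_sheaf X T E F}"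

definition cumulative_narratives ::
    "real set \<Rightarrow> real set set \<Rightarrow> ('o, 'a) cat \<Rightarrow> ('o, 'a) narrative_cat" where
  "cumulative_narratives X T E =
     full_subcategory (functor_category (poset_cat T) E) {F. is_cosheaf X T E F}"

text \<open>
  Composition with a contravariant \<open>K\<close>, on a category \<open>N\<close> of functors.  The argument \<open>A\<close> is the
  source of the composite functors.  A natural transformation from \<open>F\<close> to \<open>G\<close> with
  components \<open>\<eta>\<^sub>t\<close> yields one with components \<open>K(\<eta>\<^sub>t)\<close>, from \<open>K \<circ> G\<close> to \<open>K \<circ> F\<close>: composition
  with \<open>K\<close> is itself contravariant, that is, a functor on \<open>op_cat N\<close>.
\<close>

definition compose_with ::
    "('p, 'b, 'q, 'c) functor_data
      \<Rightarrow> ('o, 'a) cat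
      \<Rightarrow> (('o, 'a, 'p, 'b) functor_data, ('o, 'a, 'p, 'b) nat_trans) cat
      \<Rightarrow> (('o, 'a, 'p, 'b) functor_data, ('o, 'a, 'p, 'b) nat_trans,
          ('o, 'a, 'q, 'c) functor_data, ('o, 'a, 'q, 'c) nat_trans) functor_data" where
  "compose_with K A N = \<lparr>
     fobj = (\<lambda>F\<in>Obj N. functor_comp A K F),
     farr = restrict (\<lambda>(F, G, \<eta>).
       (functor_comp A K G, functor_comp A K F, \<lambda>t\<in>Obj A. farr K (\<eta> t))) (Arr N) \<rparr>"

end

(* A pullback is the limit of a cospan, and a cospan is a diagram on a category with five arrows,
   which embeds in any infinite type; so K takes pullbacks to pushouts, and composing a sheaf with K
   gives a cosheaf.  The other half is the same statement for the opposite categories, since K is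
   also a contravariant functor from the opposite of C to the opposite of D. *)

theory Submission
  imports Defs
begin

section \<open>Opposite categories\<close>

lemma op_cat_simps [simp]:
  "Obj (op_cat C) = Obj C" "Arr (op_cat C) = Arr C" "Dom (op_cat C) = Cod C"
  "Cod (op_cat C) = Dom C" "Ident (op_cat C) = Ident C" "Comp (op_cat C) g f = Comp C f g"
  by (simp_all add: op_cat_def)

lemma op_op_cat [simp]: "op_cat (op_cat C) = C"
  by (simp add: op_cat_def)

lemma Hom_op_cat [simp]: "Hom (op_cat C) x y = Hom C y x"
  by (auto simp: Hom_def)

lemma HomD: "f \<in> Hom C x y \<Longrightarrow> f \<in> Arr C \<and> Dom C f = x \<and> Cod C f = y"
  by (simp add: Hom_def)

lemma category_op_cat:
  assumes "category C"
  shows "category (op_cat C)"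
proof -
  interpret category C by fact
  show ?thesis
    by unfold_locales
      (auto simp: Dom_closed Cod_closed Ident_closed Comp_Ident_left Comp_Ident_right
        intro: Comp_closed Comp_assoc[symmetric])
qed

lemma category_op_cat_iff [simp]: "category (op_cat C) \<longleftrightarrow> category C"
  using category_op_cat[of C] category_op_cat[of "op_cat C"] by auto

lemma is_functor_op_op [simp]: "is_functor (op_cat A) (op_cat B) F \<longleftrightarrow> is_functor A B F"
  unfolding is_functor_def by auto

text \<open>A contravariant functor can carry its reversal at either end. Composites with
  \<open>K\<close> need it at the target, because \<open>K\<close> starts at
  \<open>op_cat C\<close>.\<close>

lemma is_functor_op_left: "is_functor (op_cat A) B F \<longleftrightarrow> is_functor A (op_cat B) F"
  using is_functor_op_op[of A "op_cat B" F] by simp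

text \<open>The first argument only supplies the sets to which the two maps are restricted, and
  these are the same for the opposite category.\<close>

lemma functor_comp_op [simp]: "functor_comp (op_cat A) K F = functor_comp A K F"
  by (simp add: functor_comp_def)

section \<open>Duality for limits, pullbacks and sheaves\<close>

lemma is_cone_op: "is_cone (op_cat J) (op_cat C) F L \<pi> \<longleftrightarrow> is_cocone J C F L \<pi>"
  by (simp add: is_cone_def is_cocone_def)

lemma is_cocone_op: "is_cocone (op_cat J) (op_cat C) F L \<pi> \<longleftrightarrow> is_cone J C F L \<pi>"
  by (simp add: is_cone_def is_cocone_def)

lemma is_limit_op: "is_limit (op_cat J) (op_cat C) F L \<pi> \<longleftrightarrow> is_colimit J C F L \<pi>"
  by (simp add: is_limit_def is_colimit_def is_cone_op)

lemma is_colimit_op: "is_colimit (op_cat J) (op_cat C) F L \<pi> \<longleftrightarrow> is_limit J C F L \<pi>"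
  by (simp add: is_limit_def is_colimit_def is_cocone_op)

lemma is_pullback_op [simp]: "is_pullback (op_cat C) f g p q \<longleftrightarrow> is_pushout C f g p q"
  by (simp add: is_pullback_def is_pushout_def)

text \<open>This reduces the half on cumulative narratives to the half on persistent ones. A limit
  in \<open>op_cat C\<close> is a colimit in \<open>C\<close> of the opposite diagram, and a colimit
  in \<open>op_cat D\<close> is a limit in \<open>D\<close>.\<close>

lemma takes_limits_to_colimits_op:
  fixes U :: "'u::infinite itself"
  assumes "takes_colimits_to_limits U C D K"
  shows "takes_limits_to_colimits U (op_cat C) (op_cat D) K"
  unfolding takes_limits_to_colimits_def
proof (intro allI impI, elim conjE)
  fix J :: "('u, 'u) cat" and F L \<pi>
  assume "is_functor J (op_cat C) F" "is_limit J (op_cat C) F L \<pi>"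
  then have "is_functor (op_cat J) C F" "is_colimit (op_cat J) C F L \<pi>"
    using is_limit_op[of "op_cat J" C F L \<pi>] by (simp_all add: is_functor_op_left)
  \<comment> \<open>The hypothesis is applied to the shape \<open>op_cat J\<close>, which has its
    objects and arrows in the same universe \<open>'u\<close>.\<close>
  then have "is_limit J D (functor_comp J K F) (fobj K L) (\<lambda>i. farr K (\<pi> i))"
    using assms[unfolded takes_colimits_to_limits_def, rule_format, of "op_cat J" F L \<pi>] by simp
  then show "is_colimit (op_cat J) (op_cat D) (functor_comp (op_cat J) K F) (fobj K L)
      (\<lambda>i. farr K (\<pi> i))"
    by (simp add: is_colimit_op)
qed

text \<open>Both gluing conditions list the same four arrows in the same order, so
  \<open>is_pullback_op\<close> turns one into the other, and \<open>is_functor_op_op\<close> does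
  the same for the functor part.\<close>

lemma is_sheaf_op: "is_sheaf X T (op_cat E) F \<longleftrightarrow> is_cosheaf X T E F"
  by (simp add: is_sheaf_def is_cosheaf_def)

lemma is_cosheaf_op: "is_cosheaf X T (op_cat E) F \<longleftrightarrow> is_sheaf X T E F"
  using is_sheaf_op[of X T "op_cat E" F] by simp


section \<open>Categories of functors and composition with a contravariant functor\<close>

lemma is_functorD:
  assumes "is_functor A B F"
  shows "category A" "category B"
    and "x \<in> Obj A \<Longrightarrow> fobj F x \<in> Obj B"
    and "f \<in> Arr A \<Longrightarrow> farr F f \<in> Hom B (fobj F (Dom A f)) (fobj F (Cod A f))"
    and "x \<in> Obj A \<Longrightarrow> farr F (Ident A x) = Ident B (fobj F x)"
    and "f \<in> Arr A \<Longrightarrow> g \<in> Arr A \<Longrightarrow> Cod A f = Dom A g \<Longrightarrow>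
      farr F (Comp A g f) = Comp B (farr F g) (farr F f)"
  using assms unfolding is_functor_def by auto

lemma farr_Hom:
  assumes "is_functor A B F" "f \<in> Hom A x y"
  shows "farr F f \<in> Hom B (fobj F x) (fobj F y)"
  using is_functorD(4)[OF assms(1), of f] assms(2) by (auto simp: Hom_def)

lemma farr_Comp:
  assumes "is_functor A B F" "f \<in> Hom A x y" "g \<in> Hom A y z"
  shows "farr F (Comp A g f) = Comp B (farr F g) (farr F f)"
  using is_functorD(6)[OF assms(1), of f g] assms(2,3) by (auto simp: Hom_def)

lemma functor_comp_simps [simp]:
  "x \<in> Obj A \<Longrightarrow> fobj (functor_comp A K F) x = fobj K (fobj F x)"
  "f \<in> Arr A \<Longrightarrow> farr (functor_comp A K F) f = farr K (farr F f)"
  by (simp_all add: functor_comp_def)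

lemma is_functor_comp:
  assumes F: "is_functor A B F" and K: "is_functor B C K"
  shows "is_functor A C (functor_comp A K F)"
proof -
  interpret A: category A using is_functorD(1)[OF F] .
  \<comment> \<open>The arrow map of \<open>functor_comp\<close> is restricted to
    \<open>Arr A\<close>. Its values at composites and identities can be unfolded once these are
    known to be arrows.\<close>
  have comp: "Comp A g f \<in> Arr A" if "f \<in> Arr A" "g \<in> Arr A" "Cod A f = Dom A g" for f g
    using A.Comp_closed[of f "Dom A f" "Dom A g" g "Cod A g"] that by (auto simp: Hom_def)
  have ident: "Ident A x \<in> Arr A" if "x \<in> Obj A" for x
    using A.Ident_closed[OF that] by (auto simp: Hom_def)
  have hom: "farr K (farr F f) \<in> Hom C (fobj K (fobj F (Dom A f))) (fobj K (fobj F (Cod A f)))"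
    if "f \<in> Arr A" for f
    using farr_Hom[OF K is_functorD(4)[OF F that]] .
  show ?thesis
    unfolding is_functor_def
  proof (intro conjI ballI impI)
    show "category A" "category C"
      using is_functorD(1)[OF F] is_functorD(2)[OF K] by auto
    show "fobj (functor_comp A K F) \<in> Obj A \<rightarrow>\<^sub>E Obj C"
      using is_functorD(3)[OF F] is_functorD(3)[OF K] by (auto simp: functor_comp_def)
    show "farr (functor_comp A K F) \<in> Arr A \<rightarrow>\<^sub>E Arr C"
      using hom by (auto simp: functor_comp_def Hom_def)
  next
    fix f assume "f \<in> Arr A"
    then show "farr (functor_comp A K F) f
        \<in> Hom C (fobj (functor_comp A K F) (Dom A f)) (fobj (functor_comp A K F) (Cod A f))"
      using hom by (simp add: A.Dom_closed A.Cod_closed)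
  next
    fix x assume "x \<in> Obj A"
    then show "farr (functor_comp A K F) (Ident A x) = Ident C (fobj (functor_comp A K F) x)"
      using ident is_functorD(3,5)[OF F] is_functorD(5)[OF K] by simp
  next
    fix f g assume fg: "f \<in> Arr A" "g \<in> Arr A" "Cod A f = Dom A g"
    then show "farr (functor_comp A K F) (Comp A g f)
        = Comp C (farr (functor_comp A K F) g) (farr (functor_comp A K F) f)"
      using comp is_functorD(6)[OF F fg] is_functorD(4)[OF F fg(1)] is_functorD(4)[OF F fg(2)]
        farr_Comp[OF K] by simp
  qed
qed

section \<open>Natural transformations and functor categories\<close>

lemma natural_transformationD:
  assumes "natural_transformation A B F G \<eta>"
  shows "is_functor A B F" "is_functor A B G" "\<eta> \<in> extensional (Obj A)"
    and "x \<in> Obj A \<Longrightarrow> \<eta> x \<in> Hom B (fobj F x) (fobj G x)"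
    and "f \<in> Arr A \<Longrightarrow> Comp B (\<eta> (Cod A f)) (farr F f) = Comp B (farr G f) (\<eta> (Dom A f))"
  using assms unfolding natural_transformation_def by auto

lemma natural_transformation_Ident:
  assumes "is_functor A B F"
  shows "natural_transformation A B F F (\<lambda>x\<in>Obj A. Ident B (fobj F x))"
proof -
  interpret A: category A using is_functorD(1)[OF assms] .
  interpret B: category B using is_functorD(2)[OF assms] .
  show ?thesis
    using assms is_functorD(3)[OF assms] B.Comp_Ident_left[OF is_functorD(4)[OF assms]]
      B.Comp_Ident_right[OF is_functorD(4)[OF assms]]
    by (auto simp: natural_transformation_def A.Dom_closed A.Cod_closed B.Ident_closed)
qed

lemma natural_transformation_Comp:
  assumes \<eta>: "natural_transformation A B F G \<eta>" and \<theta>: "natural_transformation A B G H \<theta>"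
  shows "natural_transformation A B F H (\<lambda>x\<in>Obj A. Comp B (\<theta> x) (\<eta> x))"
proof -
  note F = natural_transformationD(1)[OF \<eta>] and G = natural_transformationD(1)[OF \<theta>]
    and H = natural_transformationD(2)[OF \<theta>]
  interpret A: category A using is_functorD(1)[OF F] .
  interpret B: category B using is_functorD(2)[OF F] .
  \<comment> \<open>The two naturality squares are pasted along \<open>farr G f\<close>.\<close>
  have "Comp B (Comp B (\<theta> (Cod A f)) (\<eta> (Cod A f))) (farr F f)
      = Comp B (farr H f) (Comp B (\<theta> (Dom A f)) (\<eta> (Dom A f)))" if f: "f \<in> Arr A" for f
  proof -
    note hom = is_functorD(4)[OF _ f]
    note \<eta>hom = natural_transformationD(4)[OF \<eta>] and \<theta>hom = natural_transformationD(4)[OF \<theta>]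
    note obj = A.Dom_closed[OF f] A.Cod_closed[OF f]
    have "Comp B (Comp B (\<theta> (Cod A f)) (\<eta> (Cod A f))) (farr F f)
        = Comp B (\<theta> (Cod A f)) (Comp B (\<eta> (Cod A f)) (farr F f))"
      using B.Comp_assoc[OF hom[OF F] \<eta>hom \<theta>hom] obj by simp
    also have "\<dots> = Comp B (\<theta> (Cod A f)) (Comp B (farr G f) (\<eta> (Dom A f)))"
      using natural_transformationD(5)[OF \<eta> f] by simp
    also have "\<dots> = Comp B (Comp B (\<theta> (Cod A f)) (farr G f)) (\<eta> (Dom A f))"
      using B.Comp_assoc[OF \<eta>hom hom[OF G] \<theta>hom] obj by simp
    also have "\<dots> = Comp B (Comp B (farr H f) (\<theta> (Dom A f))) (\<eta> (Dom A f))"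
      using natural_transformationD(5)[OF \<theta> f] by simp
    also have "\<dots> = Comp B (farr H f) (Comp B (\<theta> (Dom A f)) (\<eta> (Dom A f)))"
      using B.Comp_assoc[OF \<eta>hom \<theta>hom hom[OF H]] obj by simp
    finally show ?thesis .
  qed
  then show ?thesis
    using F H B.Comp_closed[OF natural_transformationD(4)[OF \<eta>] natural_transformationD(4)[OF \<theta>]]
    by (auto simp: natural_transformation_def A.Dom_closed A.Cod_closed)
qed

lemma functor_category_simps [simp]:
  "Obj (functor_category A B) = {F. is_functor A B F}"
  "(F, G, \<eta>) \<in> Arr (functor_category A B) \<longleftrightarrow> natural_transformation A B F G \<eta>"
  "Dom (functor_category A B) (F, G, \<eta>) = F"
  "Cod (functor_category A B) (F, G, \<eta>) = G"
  "Ident (functor_category A B) F = (F, F, \<lambda>x\<in>Obj A. Ident B (fobj F x))"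
  "Comp (functor_category A B) (G', H, \<theta>) (F, G, \<eta>) = (F, H, \<lambda>x\<in>Obj A. Comp B (\<theta> x) (\<eta> x))"
  by (simp_all add: functor_category_def)

lemma Hom_functor_category:
  "\<phi> \<in> Hom (functor_category A B) F G \<longleftrightarrow>
    (\<exists>\<eta>. \<phi> = (F, G, \<eta>) \<and> natural_transformation A B F G \<eta>)"
  by (cases \<phi>) (auto simp: Hom_def)

text \<open>That \<open>A\<close> and \<open>B\<close> are categories is read off from
  \<open>is_functor\<close>, which holds for every object; if they are not, there are no objects and
  no arrows.\<close>

lemma category_functor_category: "category (functor_category A B)"
proof
  fix \<phi> assume "\<phi> \<in> Arr (functor_category A B)"
  then show "Dom (functor_category A B) \<phi> \<in> Obj (functor_category A B)"
    "Cod (functor_category A B) \<phi> \<in> Obj (functor_category A B)"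
    by (cases \<phi>; auto dest: natural_transformationD(1,2))+
next
  fix F assume "F \<in> Obj (functor_category A B)"
  then show "Ident (functor_category A B) F \<in> Hom (functor_category A B) F F"
    by (simp add: Hom_functor_category natural_transformation_Ident)
next
  fix \<phi> \<psi> F G H
  assume "\<phi> \<in> Hom (functor_category A B) F G" "\<psi> \<in> Hom (functor_category A B) G H"
  then show "Comp (functor_category A B) \<psi> \<phi> \<in> Hom (functor_category A B) F H"
    by (auto simp: Hom_functor_category natural_transformation_Comp)
next
  fix \<phi> F G assume "\<phi> \<in> Hom (functor_category A B) F G"
  then obtain \<eta> where \<phi>: "\<phi> = (F, G, \<eta>)" and \<eta>: "natural_transformation A B F G \<eta>"
    by (auto simp: Hom_functor_category)
  interpret B: category B using is_functorD(2)[OF natural_transformationD(1)[OF \<eta>]] .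
  \<comment> \<open>The components agree on \<open>Obj A\<close> by the unit laws of
    \<open>B\<close>, and elsewhere because \<eta> is extensional.\<close>
  show "Comp (functor_category A B) (Ident (functor_category A B) G) \<phi> = \<phi>"
    using \<phi> B.Comp_Ident_left[OF natural_transformationD(4)[OF \<eta>]]
      natural_transformationD(3)[OF \<eta>] by (auto simp: extensional_def restrict_def fun_eq_iff)
  show "Comp (functor_category A B) \<phi> (Ident (functor_category A B) F) = \<phi>"
    using \<phi> B.Comp_Ident_right[OF natural_transformationD(4)[OF \<eta>]]
      natural_transformationD(3)[OF \<eta>] by (auto simp: extensional_def restrict_def fun_eq_iff)
next
  fix \<phi> \<psi> \<chi> F G H I
  assume "\<phi> \<in> Hom (functor_category A B) F G" "\<psi> \<in> Hom (functor_category A B) G H"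
    "\<chi> \<in> Hom (functor_category A B) H I"
  then obtain \<eta> \<theta> \<kappa> where eq: "\<phi> = (F, G, \<eta>)" "\<psi> = (G, H, \<theta>)" "\<chi> = (H, I, \<kappa>)"
    and nt: "natural_transformation A B F G \<eta>" "natural_transformation A B G H \<theta>"
      "natural_transformation A B H I \<kappa>"
    by (auto simp: Hom_functor_category)
  interpret B: category B using is_functorD(2)[OF natural_transformationD(1)[OF nt(1)]] .
  show "Comp (functor_category A B) \<chi> (Comp (functor_category A B) \<psi> \<phi>)
      = Comp (functor_category A B) (Comp (functor_category A B) \<chi> \<psi>) \<phi>"
    using B.Comp_assoc[OF nt(1-3)[THEN natural_transformationD(4)]]
    by (auto simp: eq restrict_def fun_eq_iff)
qed

section \<open>Full subcategories\<close>

lemma full_subcategory_simps [simp]: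
  "Obj (full_subcategory C S) = Obj C \<inter> S"
  "f \<in> Arr (full_subcategory C S) \<longleftrightarrow> f \<in> Arr C \<and> Dom C f \<in> S \<and> Cod C f \<in> S"
  "Dom (full_subcategory C S) = Dom C" "Cod (full_subcategory C S) = Cod C"
  "Ident (full_subcategory C S) = Ident C" "Comp (full_subcategory C S) = Comp C"
  by (simp_all add: full_subcategory_def)

lemma Hom_full_subcategory:
  "f \<in> Hom (full_subcategory C S) x y \<longleftrightarrow> f \<in> Hom C x y \<and> x \<in> S \<and> y \<in> S"
  by (auto simp: Hom_def)

lemma category_full_subcategory:
  assumes "category C"
  shows "category (full_subcategory C S)"
proof -
  interpret category C by fact
  show ?thesis
    by unfold_locales
      (auto simp: Hom_full_subcategory Dom_closed Cod_closed Ident_closed Comp_Ident_left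
        Comp_Ident_right intro: Comp_closed Comp_assoc)
qed

section \<open>Composition with a contravariant functor\<close>

text \<open>\<open>K\<close> reverses the components and also both composites in the naturality
  square of \<eta>; the resulting square is the one required from \<open>K\<close> after
  \<open>G\<close> to \<open>K\<close> after \<open>F\<close>.\<close>

lemma natural_transformation_functor_comp:
  assumes \<eta>: "natural_transformation (op_cat A) C F G \<eta>" and K: "is_functor (op_cat C) D K"
  shows "natural_transformation A D (functor_comp A K G) (functor_comp A K F)
    (\<lambda>t\<in>Obj A. farr K (\<eta> t))"
proof -
  note F = natural_transformationD(1)[OF \<eta>] and G = natural_transformationD(2)[OF \<eta>]
  interpret A: category A using is_functorD(1)[OF F] by simp
  note \<eta>hom = natural_transformationD(4)[OF \<eta>, simplified]
  \<comment> \<open>A functor from \<open>op_cat A\<close> to \<open>C\<close> is one from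
    \<open>A\<close> to \<open>op_cat C\<close>, where \<open>K\<close> starts.\<close>
  have comp_functor: "is_functor A D (functor_comp A K H)" if "is_functor (op_cat A) C H" for H
    using that is_functor_comp[OF _ K] by (simp add: is_functor_op_left)
  have "Comp D (farr K (\<eta> (Cod A f))) (farr K (farr G f))
      = Comp D (farr K (farr F f)) (farr K (\<eta> (Dom A f)))" if f: "f \<in> Arr A" for f
  proof -
    note obj = A.Dom_closed[OF f] A.Cod_closed[OF f]
    \<comment> \<open>The two composites in the naturality square are treated in turn. Since
      \<open>F\<close> and \<open>G\<close> live on \<open>op_cat A\<close>, \<open>farr G f\<close>
      runs from \<open>fobj G (Cod A f)\<close> to \<open>fobj G (Dom A f)\<close>, and likewise for
      \<open>F\<close>.\<close>
    have "farr K (Comp C (farr G f) (\<eta> (Cod A f)))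
        = Comp D (farr K (\<eta> (Cod A f))) (farr K (farr G f))"
      using farr_Comp[OF K, of "farr G f" "fobj G (Dom A f)" "fobj G (Cod A f)" "\<eta> (Cod A f)"
          "fobj F (Cod A f)"]
        is_functorD(4)[OF G] \<eta>hom obj f by simp
    moreover have "farr K (Comp C (\<eta> (Dom A f)) (farr F f))
        = Comp D (farr K (farr F f)) (farr K (\<eta> (Dom A f)))"
      using farr_Comp[OF K, of "\<eta> (Dom A f)" "fobj G (Dom A f)" "fobj F (Dom A f)" "farr F f"
          "fobj F (Cod A f)"]
        is_functorD(4)[OF F] \<eta>hom obj f by simp
    ultimately show ?thesis
      using natural_transformationD(5)[OF \<eta>, of f] f by simp
  qed
  moreover have "farr K (\<eta> t) \<in> Hom D (fobj K (fobj G t)) (fobj K (fobj F t))"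
    if "t \<in> Obj A" for t
    using farr_Hom[OF K, of "\<eta> t"] \<eta>hom[OF that] by simp
  ultimately show ?thesis
    using comp_functor[OF F] comp_functor[OF G]
    by (auto simp: natural_transformation_def A.Dom_closed A.Cod_closed)
qed

text \<open>Gluing enters only through the sets \<open>S\<close> and \<open>S'\<close>. Full
  subcategories impose nothing further on arrows, so it is enough that composition with
  \<open>K\<close> sends objects in \<open>S\<close> into \<open>S'\<close>. Both halves of the
  theorem are instances, with \<open>A\<close> the time category or its opposite.\<close>

lemma is_functor_compose_with:
  assumes K: "is_functor (op_cat C) D K"
    and S: "\<And>F. is_functor (op_cat A) C F \<Longrightarrow> F \<in> S \<Longrightarrow> functor_comp A K F \<in> S'"
  defines "N \<equiv> full_subcategory (functor_category (op_cat A) C) S"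
  shows "is_functor (op_cat N) (full_subcategory (functor_category A D) S') (compose_with K A N)"
proof -
  let ?M = "full_subcategory (functor_category A D) S'"
  have N: "category N"
    unfolding N_def by (intro category_full_subcategory category_functor_category)
  have comp_functor: "is_functor A D (functor_comp A K F)" if "is_functor (op_cat A) C F" for F
    using that is_functor_comp[OF _ K] by (simp add: is_functor_op_left)
  have arrN: "(F, G, \<eta>) \<in> Arr N \<longleftrightarrow>
      natural_transformation (op_cat A) C F G \<eta> \<and> F \<in> S \<and> G \<in> S" for F G \<eta>
    by (simp add: N_def)
  have fobj: "fobj (compose_with K A N) F = functor_comp A K F"
    if "is_functor (op_cat A) C F" "F \<in> S" for F
    using that by (simp add: compose_with_def N_def)
  have farr: "farr (compose_with K A N) (F, G, \<eta>)
      = (functor_comp A K G, functor_comp A K F, \<lambda>t\<in>Obj A. farr K (\<eta> t))"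
    if "(F, G, \<eta>) \<in> Arr N" for F G \<eta>
    using that by (simp add: compose_with_def)
  have hom: "farr (compose_with K A N) \<phi>
      \<in> Hom ?M (fobj (compose_with K A N) (Cod N \<phi>)) (fobj (compose_with K A N) (Dom N \<phi>))"
    if arr: "\<phi> \<in> Arr N" for \<phi>
  proof -
    obtain F G \<eta> where \<phi>: "\<phi> = (F, G, \<eta>)"
      by (cases \<phi>)
    then have \<eta>: "natural_transformation (op_cat A) C F G \<eta>" and FG: "F \<in> S" "G \<in> S"
      using arr arrN by auto
    note FG_functors = natural_transformationD(1,2)[OF \<eta>]
    show ?thesis
      using arr natural_transformation_functor_comp[OF \<eta> K] FG FG_functors S
      by (simp add: \<phi> farr fobj Hom_full_subcategory Hom_functor_category)
        (simp add: N_def fobj[unfolded N_def])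
  qed
  show ?thesis
    unfolding is_functor_def
  proof (intro conjI ballI impI)
    show "category (op_cat N)" "category ?M"
      using N by (simp_all add: category_full_subcategory category_functor_category)
    show "fobj (compose_with K A N) \<in> Obj (op_cat N) \<rightarrow>\<^sub>E Obj ?M"
      using comp_functor S by (auto simp: compose_with_def N_def)
    have "farr (compose_with K A N) \<phi> \<in> Arr ?M" if "\<phi> \<in> Arr N" for \<phi>
      using HomD[OF hom[OF that]] by blast
    then show "farr (compose_with K A N) \<in> Arr (op_cat N) \<rightarrow>\<^sub>E Arr ?M"
      by (auto simp: compose_with_def simp del: full_subcategory_simps)
  next
    fix \<phi> assume "\<phi> \<in> Arr (op_cat N)"
    then show "farr (compose_with K A N) \<phi>
        \<in> Hom ?M (fobj (compose_with K A N) (Dom (op_cat N) \<phi>))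
            (fobj (compose_with K A N) (Cod (op_cat N) \<phi>))"
      using hom by simp
  next
    fix F assume "F \<in> Obj (op_cat N)"
    then have F: "is_functor (op_cat A) C F" "F \<in> S"
      by (auto simp: N_def)
    then have "(F, F, \<lambda>x\<in>Obj A. Ident C (fobj F x)) \<in> Arr N"
      using natural_transformation_Ident[OF F(1)] by (simp add: arrN)
    moreover have "farr K (Ident C (fobj F x)) = Ident D (fobj K (fobj F x))" if "x \<in> Obj A" for x
      using is_functorD(5)[OF K] is_functorD(3)[OF F(1)] that by simp
    ultimately show "farr (compose_with K A N) (Ident (op_cat N) F)
        = Ident ?M (fobj (compose_with K A N) F)"
      by (simp add: fobj F) (auto simp: N_def farr[unfolded N_def] fun_eq_iff restrict_def)
  next
    fix \<phi> \<psi>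
    assume "\<phi> \<in> Arr (op_cat N)" "\<psi> \<in> Arr (op_cat N)" "Cod (op_cat N) \<phi> = Dom (op_cat N) \<psi>"
    moreover obtain F G \<eta> where \<psi>: "\<psi> = (F, G, \<eta>)"
      by (cases \<psi>)
    moreover obtain G' H \<theta> where "\<phi> = (G', H, \<theta>)"
      by (cases \<phi>)
    \<comment> \<open>Composability in \<open>op_cat N\<close> says that \<phi> starts in
      \<open>N\<close> where \<psi> ends, so the composite to be mapped is \<phi> after \<psi> in
      \<open>N\<close>, with components \<theta> after \<eta>.\<close>
    ultimately have \<phi>: "\<phi> = (G, H, \<theta>)" and arr: "(G, H, \<theta>) \<in> Arr N" "(F, G, \<eta>) \<in> Arr N"
      by (auto simp: N_def)
    then have nt: "natural_transformation (op_cat A) C F G \<eta>"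
      "natural_transformation (op_cat A) C G H \<theta>" and FH: "F \<in> S" "H \<in> S"
      by (auto simp: arrN)
    have "(F, H, \<lambda>x\<in>Obj A. Comp C (\<theta> x) (\<eta> x)) \<in> Arr N"
      using natural_transformation_Comp[OF nt] FH by (simp add: arrN)
    moreover have "farr K (Comp C (\<theta> x) (\<eta> x)) = Comp D (farr K (\<eta> x)) (farr K (\<theta> x))"
      if "x \<in> Obj A" for x
      using farr_Comp[OF K, of "\<theta> x" "fobj H x" "fobj G x" "\<eta> x" "fobj F x"]
        natural_transformationD(4)[OF nt(1)] natural_transformationD(4)[OF nt(2)] that by simp
    ultimately have eq: "farr (compose_with K A N) (F, H, \<lambda>x\<in>Obj A. Comp C (\<theta> x) (\<eta> x))
        = (functor_comp A K H, functor_comp A K F,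
           \<lambda>x\<in>Obj A. Comp D (farr K (\<eta> x)) (farr K (\<theta> x)))"
      by (auto simp: farr fun_eq_iff restrict_def)
    have "Comp (op_cat N) \<psi> \<phi> = (F, H, \<lambda>x\<in>Obj A. Comp C (\<theta> x) (\<eta> x))"
      by (simp add: N_def \<phi> \<psi>)
    then show "farr (compose_with K A N) (Comp (op_cat N) \<psi> \<phi>)
        = Comp ?M (farr (compose_with K A N) \<psi>) (farr (compose_with K A N) \<phi>)"
      using arr eq by (auto simp: farr \<phi> \<psi> fun_eq_iff restrict_def)
  qed
qed


section \<open>Pullbacks as limits\<close>

text \<open>
  The objects are their own identity arrows, and two arrows are composable only if one of them is an
  identity.  The values \<open>e 0\<close> to \<open>e 4\<close> are meant to be distinct.
\<close>

definition cospan_shape :: "(nat \<Rightarrow> 'u) \<Rightarrow> ('u, 'u) cat" where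
  "cospan_shape e = \<lparr> Obj = {e 0, e 1, e 2}, Arr = {e 0, e 1, e 2, e 3, e 4},
     Dom = (\<lambda>a. if a = e 3 then e 0 else if a = e 4 then e 1 else a),
     Cod = (\<lambda>a. if a = e 3 \<or> a = e 4 then e 2 else a),
     Ident = (\<lambda>x. x),
     Comp = (\<lambda>g f. if g \<in> {e 0, e 1, e 2} then f else g) \<rparr>"

text \<open>\<open>Cod C f\<close> stands for the common target of the two legs. The last
  \<open>else\<close> is the case \<open>e 4\<close>.\<close>

definition cospan_diagram ::
    "(nat \<Rightarrow> 'u) \<Rightarrow> ('o, 'a) cat \<Rightarrow> 'a \<Rightarrow> 'a \<Rightarrow> ('u, 'u, 'o, 'a) functor_data" where
  "cospan_diagram e C f g = \<lparr>
     fobj = (\<lambda>x\<in>{e 0, e 1, e 2}.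
       if x = e 0 then Dom C f else if x = e 1 then Dom C g else Cod C f),
     farr = (\<lambda>a\<in>{e 0, e 1, e 2, e 3, e 4}.
       if a = e 0 then Ident C (Dom C f) else if a = e 1 then Ident C (Dom C g)
       else if a = e 2 then Ident C (Cod C f) else if a = e 3 then f else g) \<rparr>"

text \<open>The legs of a commuting square together with its diagonal \<open>r\<close>. The same
  family serves for cones over the cospan in \<open>C\<close> and for cocones under its image in
  \<open>D\<close>, because \<open>op_cat\<close> keeps the objects of the shape.\<close>

definition cospan_cone :: "(nat \<Rightarrow> 'u) \<Rightarrow> 'a \<Rightarrow> 'a \<Rightarrow> 'a \<Rightarrow> 'u \<Rightarrow> 'a" where
  "cospan_cone e p q r i = (if i = e 0 then p else if i = e 1 then q else r)"

lemma cospan_shape_simps [simp]: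
  "Obj (cospan_shape e) = {e 0, e 1, e 2}" "Arr (cospan_shape e) = {e 0, e 1, e 2, e 3, e 4}"
  by (simp_all add: cospan_shape_def)

context
  fixes e :: "nat \<Rightarrow> 'u"
  assumes inj: "inj e"
begin

lemma e_eq_iff [simp]: "e m = e n \<longleftrightarrow> m = n"
  using inj by (rule inj_eq)

lemma cospan_cone_simps [simp]:
  "cospan_cone e p q r (e 0) = p" "cospan_cone e p q r (e (Suc 0)) = q"
  "cospan_cone e p q r (e 2) = r"
  by (simp_all add: cospan_cone_def)

lemma category_cospan_shape: "category (cospan_shape e)"
  by unfold_locales (auto simp: cospan_shape_def Hom_def split: if_splits)

lemma is_functor_cospan_diagram:
  assumes "category C" "f \<in> Arr C" "g \<in> Arr C" "Cod C f = Cod C g"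
  shows "is_functor (cospan_shape e) C (cospan_diagram e C f g)"
proof -
  interpret category C by fact
  have hom: "f \<in> Hom C (Dom C f) (Cod C f)" "g \<in> Hom C (Dom C g) (Cod C g)"
    using assms by (auto simp: Hom_def)
  have ident: "Ident C x \<in> Arr C" "Dom C (Ident C x) = x" "Cod C (Ident C x) = x"
    "Comp C (Ident C x) (Ident C x) = Ident C x" if "x \<in> Obj C" for x
    using Ident_closed[OF that] Comp_Ident_left[OF Ident_closed[OF that]] by (auto simp: Hom_def)
  show ?thesis
    unfolding is_functor_def
    using assms category_cospan_shape ident Dom_closed[OF assms(2)] Cod_closed[OF assms(2)]
      Dom_closed[OF assms(3)] Cod_closed[OF assms(3)]
      Comp_Ident_left[OF hom(1)] Comp_Ident_right[OF hom(1)]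
      Comp_Ident_left[OF hom(2)] Comp_Ident_right[OF hom(2)]
    by (auto simp: cospan_diagram_def cospan_shape_def Hom_def)
qed

text \<open>The conditions at identity arrows are unit laws, the leg at \<open>e 2\<close> has the
  right type because it is a composite with \<open>f\<close>, and \<open>L\<close> is an object
  because it is the source of the leg at \<open>e 0\<close>. What remains is a commuting
  square.\<close>

lemma is_cone_cospan_diagram:
  assumes "category C" "f \<in> Arr C" "g \<in> Arr C" "Cod C f = Cod C g"
  shows "is_cone (cospan_shape e) C (cospan_diagram e C f g) L \<pi> \<longleftrightarrow>
    \<pi> (e 0) \<in> Hom C L (Dom C f) \<and> \<pi> (e 1) \<in> Hom C L (Dom C g) \<and>
    Comp C f (\<pi> (e 0)) = \<pi> (e 2) \<and> Comp C g (\<pi> (e 1)) = \<pi> (e 2)"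
proof -
  interpret category C by fact
  have hom: "f \<in> Hom C (Dom C f) (Cod C f)" "g \<in> Hom C (Dom C g) (Cod C g)"
    using assms by (auto simp: Hom_def)
  show ?thesis
    using Comp_closed[OF _ hom(1), of "\<pi> (e 0)" L] Comp_Ident_left[of "\<pi> (e 0)" L "Dom C f"]
      Comp_Ident_left[of "\<pi> (e 1)" L "Dom C g"] Comp_Ident_left[of "\<pi> (e 2)" L "Cod C f"]
      Dom_closed[of "\<pi> (e 0)"]
    by (auto simp: is_cone_def cospan_diagram_def cospan_shape_def Hom_def)
qed

lemma is_limit_cospan_diagram:
  assumes C: "category C" and pb: "is_pullback C f g p q"
  shows "is_limit (cospan_shape e) C (cospan_diagram e C f g) (Dom C p)
    (cospan_cone e p q (Comp C f p))"
proof -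
  interpret category C by fact
  have fg: "f \<in> Arr C" "g \<in> Arr C" "Cod C f = Cod C g"
    and pq: "p \<in> Hom C (Dom C p) (Dom C f)" "q \<in> Hom C (Dom C p) (Dom C g)"
      "Comp C f p = Comp C g q"
    and univ: "\<And>x p' q'. p' \<in> Hom C x (Dom C f) \<Longrightarrow> q' \<in> Hom C x (Dom C g) \<Longrightarrow>
      Comp C f p' = Comp C g q' \<Longrightarrow>
      \<exists>!h. h \<in> Hom C x (Dom C p) \<and> Comp C p h = p' \<and> Comp C q h = q'"
    using pb unfolding is_pullback_def by blast+
  note cone = is_cone_cospan_diagram[OF C fg]
  have f: "f \<in> Hom C (Dom C f) (Cod C f)"
    using fg by (simp add: Hom_def)
  show ?thesis
    unfolding is_limit_def
  proof (intro conjI allI impI)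
    show "is_cone (cospan_shape e) C (cospan_diagram e C f g) (Dom C p)
        (cospan_cone e p q (Comp C f p))"
      using pq by (simp add: cone)
  next
    fix M \<mu> assume "is_cone (cospan_shape e) C (cospan_diagram e C f g) M \<mu>"
    then have \<mu>: "\<mu> (e 0) \<in> Hom C M (Dom C f)" "\<mu> (e 1) \<in> Hom C M (Dom C g)"
      "Comp C f (\<mu> (e 0)) = \<mu> (e 2)" "Comp C f (\<mu> (e 0)) = Comp C g (\<mu> (e 1))"
      by (auto simp: cone)
    \<comment> \<open>By associativity the condition at \<open>e 2\<close> follows from the one at
      \<open>e 0\<close>, so mediating arrows for the limit and for the pullback are the
      same.\<close>
    have "(\<forall>i\<in>Obj (cospan_shape e). Comp C (cospan_cone e p q (Comp C f p) i) h = \<mu> i)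
        \<longleftrightarrow> Comp C p h = \<mu> (e 0) \<and> Comp C q h = \<mu> (e 1)"
      if "h \<in> Hom C M (Dom C p)" for h
      using Comp_assoc[OF that pq(1) f] \<mu>(3) by auto
    then show "\<exists>!h. h \<in> Hom C M (Dom C p) \<and>
        (\<forall>i\<in>Obj (cospan_shape e). Comp C (cospan_cone e p q (Comp C f p) i) h = \<mu> i)"
      using univ[OF \<mu>(1,2,4)] by (simp cong: conj_cong)
  qed
qed

text \<open>Supplies the cocones on which the pushout property is tested: a commuting square under
  the image of the cospan becomes a cocone once its diagonal is added. At identity arrows this uses
  that \<open>K\<close> preserves identities.\<close>

lemma is_cocone_functor_comp_cospan:
  assumes K: "is_functor (op_cat C) D K"
    and C: "category C" and fg: "f \<in> Arr C" "g \<in> Arr C" "Cod C f = Cod C g"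
    and p: "p \<in> Hom D (fobj K (Dom C f)) x" and q: "q \<in> Hom D (fobj K (Dom C g)) x"
    and comm: "Comp D p (farr K f) = Comp D q (farr K g)"
  shows "is_cocone (op_cat (cospan_shape e)) D
    (functor_comp (op_cat (cospan_shape e)) K (cospan_diagram e C f g)) x
    (cospan_cone e p q (Comp D p (farr K f)))"
proof -
  interpret C: category C by fact
  interpret D: category D using is_functorD(2)[OF K] .
  have homs: "farr K f \<in> Hom D (fobj K (Cod C f)) (fobj K (Dom C f))"
    using is_functorD(4)[OF K, of f] fg by simp
  note r = D.Comp_closed[OF homs p]
  have ident: "farr K (Ident C y) = Ident D (fobj K y)" if "y \<in> Obj C" for y
    using is_functorD(5)[OF K] that by simp
  show ?thesis
    using p q r comm D.Comp_Ident_right[OF p] D.Comp_Ident_right[OF q] D.Comp_Ident_right[OF r]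
      ident[OF C.Dom_closed[OF fg(1)]] ident[OF C.Dom_closed[OF fg(2)]]
      ident[OF C.Cod_closed[OF fg(1)]] D.Cod_closed[of p] HomD[OF p] fg(3)
    by (auto simp: is_cocone_def functor_comp_def cospan_diagram_def cospan_shape_def
        cospan_cone_def)
qed

end

section \<open>From pullbacks to pushouts, and from sheaves to cosheaves\<close>

lemma pullback_to_pushout:
  fixes U :: "'u::infinite itself"
  assumes K: "is_functor (op_cat C) D K" and lim: "takes_limits_to_colimits U C D K"
    and pb: "is_pullback C f g p q"
  shows "is_pushout D (farr K f) (farr K g) (farr K p) (farr K q)"
proof -
  interpret C: category C using is_functorD(1)[OF K] by simp
  interpret D: category D using is_functorD(2)[OF K] .
  \<comment> \<open>An infinite universe has room for the five distinct arrows of the cospan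
    shape.\<close>
  obtain e :: "nat \<Rightarrow> 'u" where e: "inj e"
    using infinite_countable_subset[OF infinite_UNIV] by blast
  note [simp] = cospan_cone_simps[OF e]
  have fg: "f \<in> Arr C" "g \<in> Arr C" "Cod C f = Cod C g"
    and pq: "p \<in> Hom C (Dom C p) (Dom C f)" "q \<in> Hom C (Dom C p) (Dom C g)"
      "Comp C f p = Comp C g q"
    using pb unfolding is_pullback_def by blast+
  have hom: "farr K h \<in> Hom D (fobj K y) (fobj K x)" if "h \<in> Hom C x y" for h x y
    using farr_Hom[OF K] that by simp
  have comp: "farr K (Comp C h' h) = Comp D (farr K h) (farr K h')"
    if "h \<in> Hom C x y" "h' \<in> Hom C y z" for h h' x y z
    using farr_Comp[OF K, of h' z y h x] that by simp
  have f: "f \<in> Hom C (Dom C f) (Cod C f)" and g: "g \<in> Hom C (Dom C g) (Cod C f)"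
    using fg by (auto simp: Hom_def)
  note D_homs = hom[OF f] hom[OF g] hom[OF pq(1)] hom[OF pq(2)]
  let ?J = "cospan_shape e" and ?F = "cospan_diagram e C f g"
  let ?\<iota> = "\<lambda>i. farr K (cospan_cone e p q (Comp C f p) i)"
  have "is_colimit (op_cat ?J) D (functor_comp (op_cat ?J) K ?F) (fobj K (Dom C p)) ?\<iota>"
    using lim is_functor_cospan_diagram[OF e C.category_axioms fg]
      is_limit_cospan_diagram[OF e C.category_axioms pb]
    unfolding takes_limits_to_colimits_def by blast
  \<comment> \<open>The colimit property, specialised to the cocone built from a commuting square
    \<open>p'\<close>, \<open>q'\<close>.\<close>
  then have univ: "\<exists>!h. h \<in> Hom D (fobj K (Dom C p)) x \<and>
      (\<forall>i\<in>Obj (op_cat ?J). Comp D h (?\<iota> i) = cospan_cone e p' q' (Comp D p' (farr K f)) i)"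
    if "p' \<in> Hom D (fobj K (Dom C f)) x" "q' \<in> Hom D (fobj K (Dom C g)) x"
      "Comp D p' (farr K f) = Comp D q' (farr K g)" for x p' q'
    using is_cocone_functor_comp_cospan[OF e K C.category_axioms fg that]
    unfolding is_colimit_def by blast
  have "\<exists>!h. h \<in> Hom D (fobj K (Dom C p)) x \<and>
      Comp D h (farr K p) = p' \<and> Comp D h (farr K q) = q'"
    if p': "p' \<in> Hom D (fobj K (Dom C f)) x" and q': "q' \<in> Hom D (fobj K (Dom C g)) x"
      and eq: "Comp D p' (farr K f) = Comp D q' (farr K g)" for x p' q'
  proof -
    \<comment> \<open>At \<open>e 2\<close> the leg is the image of \<open>f\<close> after
      \<open>p\<close>, that is \<open>farr K p\<close> after \<open>farr K f\<close>; the condition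
      there follows from the one at \<open>e 0\<close> by associativity.\<close>
    have "(\<forall>i\<in>Obj (op_cat ?J). Comp D h (?\<iota> i) = cospan_cone e p' q' (Comp D p' (farr K f)) i)
        \<longleftrightarrow> Comp D h (farr K p) = p' \<and> Comp D h (farr K q) = q'"
      if "h \<in> Hom D (fobj K (Dom C p)) x" for h
      using D.Comp_assoc[OF D_homs(1) D_homs(3) that] comp[OF pq(1) f] by auto
    then show ?thesis
      using univ[OF that] by (simp cong: conj_cong)
  qed
  moreover have "Comp D (farr K p) (farr K f) = Comp D (farr K q) (farr K g)"
    using comp[OF pq(1) f] comp[OF pq(2) g] pq(3) by simp
  ultimately show ?thesis
    \<comment> \<open>\<open>is_pushout\<close> names the corners through \<open>Dom\<close> and
      \<open>Cod\<close> of the image arrows; \<open>HomD\<close> identifies them with the images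
      under \<open>fobj K\<close>.\<close>
    using D_homs[THEN HomD] D_homs unfolding is_pushout_def by auto
qed


section \<open>Narratives\<close>

lemma is_cosheaf_functor_comp:
  assumes K: "is_functor (op_cat C) D K" and lim: "takes_limits_to_colimits U C D K"
    and F: "is_sheaf X T C F"
  shows "is_cosheaf X T D (functor_comp (poset_cat T) K F)"
  unfolding is_cosheaf_def
proof (intro conjI allI impI)
  have "is_functor (poset_cat T) (op_cat C) F"
    using F by (simp add: is_sheaf_def is_functor_op_left)
  then show "is_functor (poset_cat T) D (functor_comp (poset_cat T) K F)"
    by (rule is_functor_comp[OF _ K])
next
  fix a p b assume cover: "is_cover X T a p b"
  \<comment> \<open>A cover has all four intervals in \<open>T\<close>, including the overlap, so
    the inclusions are arrows at which the restricted map of \<open>functor_comp\<close> is given by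
    \<open>K\<close>.\<close>
  then have "(ivl X p p, ivl X a p) \<in> Arr (poset_cat T)" "(ivl X p p, ivl X p b) \<in> Arr (poset_cat T)"
    "(ivl X a p, ivl X a b) \<in> Arr (poset_cat T)" "(ivl X p b, ivl X a b) \<in> Arr (poset_cat T)"
    by (auto simp: is_cover_def poset_cat_def ivl_def)
  then show "is_pushout D
      (farr (functor_comp (poset_cat T) K F) (ivl X p p, ivl X a p))
      (farr (functor_comp (poset_cat T) K F) (ivl X p p, ivl X p b))
      (farr (functor_comp (poset_cat T) K F) (ivl X a p, ivl X a b))
      (farr (functor_comp (poset_cat T) K F) (ivl X p b, ivl X a b))"
    using F cover pullback_to_pushout[OF K lim] by (simp add: is_sheaf_def)
qed

text \<open>This is \<open>is_cosheaf_functor_comp\<close> for \<open>op_cat C\<close> and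
  \<open>op_cat D\<close>: the cosheaf \<open>F\<close> is a sheaf with values in
  \<open>op_cat C\<close>, and a cosheaf with values in \<open>op_cat D\<close> is a sheaf with
  values in \<open>D\<close>.\<close>

lemma is_sheaf_functor_comp:
  assumes "is_functor (op_cat C) D K" and "takes_colimits_to_limits U C D K"
    and "is_cosheaf X T C F"
  shows "is_sheaf X T D (functor_comp (poset_cat T) K F)"
  using is_cosheaf_functor_comp[of "op_cat C" "op_cat D" K U X T F] assms
    takes_limits_to_colimits_op[OF assms(2)]
  by (simp add: is_functor_op_left is_sheaf_op is_cosheaf_op)

theorem proposition2p16:
  fixes C :: "('o, 'a) cat" and D :: "('p, 'b) cat"
    and K :: "('o, 'a, 'p, 'b) functor_data"
    and X :: "real set" and T :: "real set set"
  assumes "category C" and "category D"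
    and "time_category X T"
    and "is_functor (op_cat C) D K"
  shows "(has_limits TYPE('u::infinite) C \<and> has_colimits TYPE('u) D \<and>
            takes_limits_to_colimits TYPE('u) C D K \<longrightarrow>
          is_functor (op_cat (persistent_narratives X T C)) (cumulative_narratives X T D)
            (compose_with K (poset_cat T) (persistent_narratives X T C))) \<and>
         (has_colimits TYPE('u) C \<and> has_limits TYPE('u) D \<and>
            takes_colimits_to_limits TYPE('u) C D K \<longrightarrow>
          is_functor (op_cat (cumulative_narratives X T C)) (persistent_narratives X T D)
            (compose_with K (op_cat (poset_cat T)) (cumulative_narratives X T C)))"
proof (intro conjI impI; elim conjE)
  assume "takes_limits_to_colimits TYPE('u) C D K"
  then show "is_functor (op_cat (persistent_narratives X T C)) (cumulative_narratives X T D)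
      (compose_with K (poset_cat T) (persistent_narratives X T C))"
    unfolding persistent_narratives_def cumulative_narratives_def
    using is_cosheaf_functor_comp[OF assms(4)] by (intro is_functor_compose_with[OF assms(4)]) auto
next
  assume "takes_colimits_to_limits TYPE('u) C D K"
  then show "is_functor (op_cat (cumulative_narratives X T C)) (persistent_narratives X T D)
      (compose_with K (op_cat (poset_cat T)) (cumulative_narratives X T C))"
    unfolding persistent_narratives_def cumulative_narratives_def
    \<comment> \<open>Cosheaves are functors on \<open>poset_cat T\<close>, the opposite of
      \<open>op_cat (poset_cat T)\<close>; so the general lemma is used with \<open>A\<close> the
      opposite of the time category.\<close>
    using is_sheaf_functor_comp[OF assms(4)]
      is_functor_compose_with[OF assms(4), where A = "op_cat (poset_cat T)" and
        S = "{F. is_cosheaf X T C F}" and S' = "{F. is_sheaf X T D F}", unfolded op_op_cat]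
    by (metis functor_comp_op mem_Collect_eq)
qed

end
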